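(* Let $n \ge 1$ and let $G_n$ be the graph with vertex set $\mathbb{Z}^n$ in which $u,v$ are adjacent iff $\|u-v\|_\infty = 1$. Let $S \subset \mathbb{Z}^n$ be a finite set. Then $$|\partial_e(S)| = \sum_{\epsilon \in \{-1,0,1\}^n,\ \epsilon \neq 0} \left( |P_\epsilon(S)| + |\mathrm{gap}_\epsilon(S)| \right).$$
   Context: Edges are unordered pairs. For $A \subset \mathbb{Z}^n$, the edge boundary is $\partial_e(A) = \{\{x,y\} : \|x-y\|_\infty = 1,\ |A \cap \{x,y\}| = 1\}$. For nonzero $\epsilon \in \{-1,0,1\}^n$, $P_\epsilon(S)$ is the orthogonal projection of $S$ onto the hyperplane $\epsilon^\perp$, i.e. $P_\epsilon(S) = \{u - \frac{\langle u,\epsilon\rangle}{\|\epsilon\|_2^2}\epsilon : u \in S\}$, where $\langle\cdot,\cdot\rangle$ is the standard inner product. Also $\mathrm{gap}_\epsilon(S) = \{x \in \mathbb{Z}^n : x - \epsilon \in S,\ x \notin S,\ \text{and } x + b\epsilon \in S \text{ for some integer } b \ge 1\}$. *)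

theory Defs
  imports "HOL-Analysis.Analysis"
begin

text \<open>
  The lattice $\mathbb{Z}^n$ is the set of points of \<^typ>\<open>real ^ 'n\<close> with integer coordinates,
  so that the library's inner product, Euclidean norm and maximum norm (\<^const>\<open>infnorm\<close>)
  apply directly. The dimension is $n = \mathrm{CARD}('n) \ge 1$.
\<close>

definition int_lattice :: "(real ^ 'n) set" where
  "int_lattice = {x. \<forall>i. x $ i \<in> \<int>}"

definition Gn_edges :: "(real ^ 'n) set set" where
  "Gn_edges = {{u, v} | u v. u \<in> int_lattice \<and> v \<in> int_lattice \<and> infnorm (u - v) = 1}"

definition edge_boundary :: "(real ^ 'n) set \<Rightarrow> (real ^ 'n) set set" where
  "edge_boundary A = {e \<in> Gn_edges. card (A \<inter> e) = 1}"

definition directions :: "(real ^ 'n) set" where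
  "directions = {\<epsilon>. (\<forall>i. \<epsilon> $ i \<in> {-1, 0, 1}) \<and> \<epsilon> \<noteq> 0}"

definition proj :: "real ^ 'n \<Rightarrow> (real ^ 'n) set \<Rightarrow> (real ^ 'n) set" where
  "proj \<epsilon> S = {u - ((u \<bullet> \<epsilon>) / (norm \<epsilon>)\<^sup>2) *\<^sub>R \<epsilon> | u. u \<in> S}"

definition gap :: "real ^ 'n \<Rightarrow> (real ^ 'n) set \<Rightarrow> (real ^ 'n) set" where
  "gap \<epsilon> S = {x \<in> int_lattice. x - \<epsilon> \<in> S \<and> x \<notin> S \<and>
                 (\<exists>b::int. b \<ge> 1 \<and> x + of_int b *\<^sub>R \<epsilon> \<in> S)}"

end

theory Submission
  imports Defs
begin

text \<open>
  Directing each boundary edge away from S gives a bijection between the boundary and the pairs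
  (x, e) with e a direction, x in S and x + e outside S. For fixed e such an x is either the
  last point of S on its line parallel to e, and these points correspond to the points of the
  projection, or S is met again further along the line, and then x + e is a gap point.
\<close>

text \<open>The supremum behind \<open>infnorm\<close> runs over finitely many coordinates and is
  therefore attained; in the form \<open>Max\<close> the norm can be found by exhibiting a maximal
  coordinate.\<close>

lemma infnorm_eq_Max_cart: "infnorm (x :: real ^ 'n) = Max (range (\<lambda>i. \<bar>x $ i\<bar>))"
proof -
  have "{\<bar>x $ i\<bar> |i. i \<in> UNIV} = range (\<lambda>i. \<bar>x $ i\<bar>)" by auto
  then show ?thesis unfolding infnorm_cart by (simp add: cSup_eq_Max)
qed

lemma abs_Ints_le_1:
  fixes r :: real
  assumes "r \<in> \<int>" "\<bar>r\<bar> \<le> 1"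
  shows "r \<in> {-1, 0, 1}"
proof -
  obtain k where k: "r = of_int k" using assms(1) by (auto elim: Ints_cases)
  with assms(2) have "\<bar>k\<bar> \<le> 1" by linarith
  then have "k = -1 \<or> k = 0 \<or> k = 1" by linarith
  with k show ?thesis by auto
qed

lemma directions_subset_int_lattice: "directions \<subseteq> int_lattice"
proof
  fix x :: "real ^ 'n" assume "x \<in> directions"
  then have *: "x $ i = -1 \<or> x $ i = 0 \<or> x $ i = 1" for i by (simp add: directions_def)
  have "x $ i \<in> \<int>" for i using *[of i] by auto
  then show "x \<in> int_lattice" by (simp add: int_lattice_def)
qed

text \<open>An integer of absolute value at most 1 is -1, 0 or 1, and a nonzero vector with such
  entries attains the value 1. This turns adjacency of lattice points into a condition on their
  difference.\<close>

lemma directions_iff_infnorm: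
  assumes "x \<in> int_lattice"
  shows "x \<in> directions \<longleftrightarrow> infnorm x = 1"
proof
  assume x: "x \<in> directions"
  then have *: "\<bar>x $ i\<bar> \<le> 1" for i
    by (auto simp: directions_def dest!: spec[of _ i])
  obtain i where "x $ i \<noteq> 0" using x by (auto simp: directions_def vec_eq_iff)
  then have "\<bar>x $ i\<bar> = 1"
    using x by (auto simp: directions_def dest!: spec[of _ i])
  then show "infnorm x = 1"
    unfolding infnorm_eq_Max_cart using * by (intro Max_eqI) (auto intro: rev_image_eqI)
next
  assume x: "infnorm x = 1"
  have "\<bar>x $ i\<bar> \<le> 1" for i
    using component_le_infnorm_cart[of x i] x by simp
  moreover have "x $ i \<in> \<int>" for i using assms by (simp add: int_lattice_def)
  ultimately have "\<forall>i. x $ i \<in> {-1, 0, 1}" using abs_Ints_le_1 by blast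
  moreover have "x \<noteq> 0" using x by (auto simp: infnorm_0)
  ultimately show "x \<in> directions" by (simp add: directions_def)
qed

text \<open>A vector is determined by its coordinate function, and there are only finitely many
  functions from the finite index type to a set of three values.\<close>

lemma finite_directions: "finite (directions :: (real ^ 'n) set)"
proof (rule finite_imageD)
  show "inj_on vec_nth (directions :: (real ^ 'n) set)" by (simp add: inj_on_def vec_nth_inject)
  have "vec_nth ` (directions :: (real ^ 'n) set) \<subseteq> PiE UNIV (\<lambda>_. {-1, 0, 1})"
    by (auto simp: directions_def)
  then show "finite (vec_nth ` (directions :: (real ^ 'n) set))"
    by (rule finite_subset) (simp add: finite_PiE)
qed

lemma int_lattice_add: "x \<in> int_lattice \<Longrightarrow> y \<in> int_lattice \<Longrightarrow> x + y \<in> int_lattice"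
  by (simp add: int_lattice_def)

lemma int_lattice_diff: "x \<in> int_lattice \<Longrightarrow> y \<in> int_lattice \<Longrightarrow> x - y \<in> int_lattice"
  by (simp add: int_lattice_def)

definition exits :: "real ^ 'n \<Rightarrow> (real ^ 'n) set \<Rightarrow> (real ^ 'n) set" where
  "exits \<epsilon> S = {x \<in> S. x + \<epsilon> \<notin> S}"

text \<open>Here \<open>b\<close> ranges over all positive integers, so \<open>S\<close> is never
  met again along the ray; \<open>exits\<close> looks only at the first step.\<close>

definition last_points :: "real ^ 'n \<Rightarrow> (real ^ 'n) set \<Rightarrow> (real ^ 'n) set" where
  "last_points \<epsilon> S = {x \<in> S. \<forall>b::int. b \<ge> 1 \<longrightarrow> x + of_int b *\<^sub>R \<epsilon> \<notin> S}"

lemma edge_boundary_eq_image: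
  assumes "S \<subseteq> int_lattice"
  shows "edge_boundary S = (\<lambda>(\<epsilon>, x). {x, x + \<epsilon>}) ` (SIGMA \<epsilon>:directions. exits \<epsilon> S)"
proof (intro equalityI subsetI)
  \<comment> \<open>The oriented form, with the inner endpoint \<open>u\<close> named first, serves
    both cases below, since either end of an unordered edge may be the one in
    \<open>S\<close>.\<close>
  have *: "{u, v} \<in> (\<lambda>(\<epsilon>, x). {x, x + \<epsilon>}) ` (SIGMA \<epsilon>:directions. exits \<epsilon> S)"
    if "u \<in> S" "v \<notin> S" "v \<in> int_lattice" "infnorm (u - v) = 1" for u v
  proof (rule image_eqI)
    have "v - u \<in> directions"
      using that assms by (subst directions_iff_infnorm)
        (auto intro!: int_lattice_diff simp: infnorm_sub)
    then show "(v - u, u) \<in> (SIGMA \<epsilon>:directions. exits \<epsilon> S)"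
      using that by (simp add: exits_def)
  qed simp
  fix e assume e: "e \<in> edge_boundary S"
  then obtain u v where uv: "e = {u, v}" "u \<in> int_lattice" "v \<in> int_lattice" "infnorm (u - v) = 1"
    by (auto simp: edge_boundary_def Gn_edges_def)
  \<comment> \<open>Without this, two endpoints in \<open>S\<close> could collapse to a set of
    cardinality 1.\<close>
  have ne: "u \<noteq> v" using uv(4) by (auto simp: infnorm_0)
  have 1: "card (S \<inter> {u, v}) = 1" using e uv(1) by (simp add: edge_boundary_def)
  have "\<not> (u \<in> S \<longleftrightarrow> v \<in> S)"
  proof
    assume "u \<in> S \<longleftrightarrow> v \<in> S"
    then have "S \<inter> {u, v} = {} \<or> S \<inter> {u, v} = {u, v}" by auto
    then show False using 1 ne by auto
  qed
  then consider "u \<in> S" "v \<notin> S" | "v \<in> S" "u \<notin> S" by blast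
  then show "e \<in> (\<lambda>(\<epsilon>, x). {x, x + \<epsilon>}) ` (SIGMA \<epsilon>:directions. exits \<epsilon> S)"
  proof cases
    case 1
    then show ?thesis using *[of u v] uv by simp
  next
    case 2
    then show ?thesis using *[of v u] uv by (simp add: insert_commute infnorm_sub)
  qed
next
  fix e assume "e \<in> (\<lambda>(\<epsilon>, x). {x, x + \<epsilon>}) ` (SIGMA \<epsilon>:directions. exits \<epsilon> S)"
  then obtain \<epsilon> x where e: "\<epsilon> \<in> directions" "x \<in> S" "x + \<epsilon> \<notin> S" "e = {x, x + \<epsilon>}"
    by (auto simp: exits_def)
  have "\<epsilon> \<in> int_lattice" using e(1) directions_subset_int_lattice by blast
  then have "x + \<epsilon> \<in> int_lattice" "infnorm (x - (x + \<epsilon>)) = 1" "x \<in> int_lattice"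
    using e assms directions_iff_infnorm by (auto intro: int_lattice_add simp: infnorm_neg)
  then have "e \<in> Gn_edges" using e(4) unfolding Gn_edges_def by blast
  moreover have "S \<inter> e = {x}" using e by auto
  ultimately show "e \<in> edge_boundary S" by (simp add: edge_boundary_def)
qed

lemma card_edge_boundary:
  assumes "S \<subseteq> int_lattice" "finite S"
  shows "card (edge_boundary S) = (\<Sum>\<epsilon>\<in>directions. card (exits \<epsilon> S))"
proof -
  have "inj_on (\<lambda>(\<epsilon>, x). {x, x + \<epsilon>}) (SIGMA \<epsilon>:directions. exits \<epsilon> S)"
  proof (rule inj_onI, clarify)
    fix \<epsilon> x \<delta> y
    assume "x \<in> exits \<epsilon> S" "y \<in> exits \<delta> S" "{x, x + \<epsilon>} = {y, y + \<delta>}"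
    then show "\<epsilon> = \<delta> \<and> x = y"
      \<comment> \<open>The crosswise match is impossible: it would give
        \<open>y = x + \<epsilon>\<close>, with \<open>y\<close> in \<open>S\<close> and
        \<open>x + \<epsilon>\<close> outside it.\<close>
      by (auto simp: exits_def doubleton_eq_iff)
  qed
  moreover have "finite (exits \<epsilon> S)" for \<epsilon> using assms(2) by (simp add: exits_def)
  ultimately show ?thesis
    by (simp add: edge_boundary_eq_image[OF assms(1)] card_image card_SigmaI finite_directions)
qed

text \<open>Equal projections only make the difference a real multiple of \<open>\<epsilon>\<close>.
  Some coordinate of \<open>\<epsilon>\<close> is 1 or -1, and reading off the difference there
  shows that the factor is an integer.\<close>

lemma line_projection_eq:
  fixes x y \<epsilon> :: "real ^ 'n"
  assumes "x \<in> int_lattice" "y \<in> int_lattice" "\<epsilon> \<in> directions"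
    and "x - ((x \<bullet> \<epsilon>) / (norm \<epsilon>)\<^sup>2) *\<^sub>R \<epsilon> = y - ((y \<bullet> \<epsilon>) / (norm \<epsilon>)\<^sup>2) *\<^sub>R \<epsilon>"
  obtains k :: int where "x = y + of_int k *\<^sub>R \<epsilon>"
proof -
  define t where "t = (x \<bullet> \<epsilon>) / (norm \<epsilon>)\<^sup>2 - (y \<bullet> \<epsilon>) / (norm \<epsilon>)\<^sup>2"
  have xy: "x = y + t *\<^sub>R \<epsilon>" using assms(4) by (simp add: t_def algebra_simps)
  obtain i where i: "\<epsilon> $ i \<noteq> 0" using assms(3) by (auto simp: directions_def vec_eq_iff)
  then have "\<epsilon> $ i = 1 \<or> \<epsilon> $ i = -1"
    using assms(3) by (auto simp: directions_def dest!: spec[of _ i])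
  moreover have "x $ i - y $ i = t * \<epsilon> $ i" using xy by simp
  ultimately have "t = x $ i - y $ i \<or> t = y $ i - x $ i" by auto
  moreover have "x $ i \<in> \<int>" "y $ i \<in> \<int>" using assms(1,2) by (auto simp: int_lattice_def)
  ultimately have "t \<in> \<int>" by auto
  then show ?thesis using xy that by (auto elim: Ints_cases)
qed

text \<open>Every fibre of the projection on \<open>S\<close> contains exactly one last point: two
  of them would lie an integer number of steps apart, and finiteness of \<open>S\<close> provides
  one.\<close>

lemma card_last_points:
  assumes "S \<subseteq> int_lattice" "finite S" "\<epsilon> \<in> directions"
  shows "card (last_points \<epsilon> S) = card (proj \<epsilon> S)"
proof -
  define p where "p u = u - ((u \<bullet> \<epsilon>) / (norm \<epsilon>)\<^sup>2) *\<^sub>R \<epsilon>" for u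
  have \<epsilon>: "\<epsilon> \<noteq> 0" using assms(3) by (simp add: directions_def)
  then have p_add: "p (u + t *\<^sub>R \<epsilon>) = p u" for u t
    by (simp add: p_def inner_add_left power2_norm_eq_inner add_divide_distrib scaleR_add_left)
  have inj: "inj_on p (last_points \<epsilon> S)"
  proof (rule inj_onI)
    fix x y assume xy: "x \<in> last_points \<epsilon> S" "y \<in> last_points \<epsilon> S" "p x = p y"
    then have "x \<in> S" "y \<in> S" by (auto simp: last_points_def)
    then obtain k :: int where k: "x = y + of_int k *\<^sub>R \<epsilon>"
      using xy(3) assms line_projection_eq[of x y \<epsilon>] unfolding p_def by blast
    then have "y = x + of_int (- k) *\<^sub>R \<epsilon>" by simp
    \<comment> \<open>Whichever of the two points came strictly earlier on the line would see the
      other ahead of it in \<open>S\<close>, so both signs of \<open>k\<close> are excluded.\<close>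
    then have "\<not> - k \<ge> 1" using xy(1) \<open>y \<in> S\<close> unfolding last_points_def by blast
    moreover have "\<not> k \<ge> 1" using xy(2) \<open>x \<in> S\<close> k unfolding last_points_def by blast
    ultimately have "k = 0" by linarith
    then show "x = y" using k by simp
  qed
  have "p ` S \<subseteq> p ` last_points \<epsilon> S"
  proof (rule image_subsetI)
    fix u assume u: "u \<in> S"
    \<comment> \<open>\<open>F\<close> is the fibre through \<open>u\<close>. A point of
      \<open>F\<close> with the largest inner product with \<open>\<epsilon>\<close> is last,
      because \<open>b\<close> further steps stay in the fibre and raise that product by
      \<open>b * (\<epsilon> \<bullet> \<epsilon>) > 0\<close>.\<close>
    define F where "F = {v \<in> S. p v = p u}"
    have "finite F" "F \<noteq> {}" using assms(2) u by (auto simp: F_def)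
    then obtain v where v: "v \<in> F" "\<And>w. w \<in> F \<Longrightarrow> w \<bullet> \<epsilon> \<le> v \<bullet> \<epsilon>"
      using Max_in[of "(\<lambda>w. w \<bullet> \<epsilon>) ` F"] Max_ge[of "(\<lambda>w. w \<bullet> \<epsilon>) ` F"] by fastforce
    have "v + of_int b *\<^sub>R \<epsilon> \<notin> S" if "b \<ge> 1" for b :: int
    proof
      assume "v + of_int b *\<^sub>R \<epsilon> \<in> S"
      then have "v + of_int b *\<^sub>R \<epsilon> \<in> F" using v(1) by (simp add: F_def p_add)
      then have "of_int b * (\<epsilon> \<bullet> \<epsilon>) \<le> 0" using v(2) by (fastforce simp: inner_add_left)
      moreover have "of_int b * (\<epsilon> \<bullet> \<epsilon>) > 0" using that \<epsilon> by simp
      ultimately show False by linarith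
    qed
    then have "v \<in> last_points \<epsilon> S" "p u = p v" using v(1) by (auto simp: last_points_def F_def)
    then show "p u \<in> p ` last_points \<epsilon> S" by blast
  qed
  then have "p ` last_points \<epsilon> S = p ` S" by (auto simp: last_points_def)
  also have "p ` S = proj \<epsilon> S" by (auto simp: proj_def p_def)
  finally show ?thesis using card_image[OF inj] by simp
qed

lemma gap_eq_image:
  assumes "S \<subseteq> int_lattice" "\<epsilon> \<in> directions"
  shows "gap \<epsilon> S = (\<lambda>x. x + \<epsilon>) ` (exits \<epsilon> S - last_points \<epsilon> S)"
proof (intro equalityI subsetI)
  fix y assume y: "y \<in> gap \<epsilon> S"
  then obtain b :: int where b: "b \<ge> 1" "y + of_int b *\<^sub>R \<epsilon> \<in> S" by (auto simp: gap_def)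
  \<comment> \<open>The return to \<open>S\<close> is counted from \<open>y\<close> in
    \<open>gap\<close> but from the preceding point in \<open>last_points\<close>, hence the shift
    by one.\<close>
  have "(y - \<epsilon>) + of_int (b + 1) *\<^sub>R \<epsilon> \<in> S" using b(2) by (simp add: algebra_simps)
  moreover have "b + 1 \<ge> 1" using b(1) by simp
  ultimately have "y - \<epsilon> \<notin> last_points \<epsilon> S" unfolding last_points_def by blast
  moreover have "y - \<epsilon> \<in> exits \<epsilon> S" using y by (simp add: gap_def exits_def)
  ultimately show "y \<in> (\<lambda>x. x + \<epsilon>) ` (exits \<epsilon> S - last_points \<epsilon> S)"
    by (intro image_eqI[of _ _ "y - \<epsilon>"]) auto
next
  fix y assume "y \<in> (\<lambda>x. x + \<epsilon>) ` (exits \<epsilon> S - last_points \<epsilon> S)"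
  then obtain x where x: "y = x + \<epsilon>" "x \<in> S" "x + \<epsilon> \<notin> S" "x \<notin> last_points \<epsilon> S"
    by (auto simp: exits_def)
  then obtain b :: int where b: "b \<ge> 1" "x + of_int b *\<^sub>R \<epsilon> \<in> S" by (auto simp: last_points_def)
  \<comment> \<open>The first step leaves \<open>S\<close>, so the return takes at least two steps
    from \<open>x\<close>, hence at least one from \<open>y\<close>.\<close>
  have "b \<noteq> 1" using b(2) x(3) by auto
  then have "b - 1 \<ge> 1" using b(1) by simp
  moreover have "y + of_int (b - 1) *\<^sub>R \<epsilon> \<in> S" using b(2) x(1) by (simp add: algebra_simps)
  moreover have "y \<in> int_lattice"
    using x(1,2) assms directions_subset_int_lattice by (auto intro: int_lattice_add)
  ultimately show "y \<in> gap \<epsilon> S"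
    using x(1-3) unfolding gap_def mem_Collect_eq by (metis add_diff_cancel_right')
qed

lemma card_exits:
  assumes "S \<subseteq> int_lattice" "finite S" "\<epsilon> \<in> directions"
  shows "card (exits \<epsilon> S) = card (proj \<epsilon> S) + card (gap \<epsilon> S)"
proof -
  \<comment> \<open>The case \<open>b = 1\<close> of the condition on last points is the exit
    condition.\<close>
  have sub: "last_points \<epsilon> S \<subseteq> exits \<epsilon> S"
    unfolding last_points_def exits_def by (auto dest: spec[of _ 1])
  have fin: "finite (exits \<epsilon> S)" using assms(2) by (simp add: exits_def)
  have "card (gap \<epsilon> S) = card (exits \<epsilon> S - last_points \<epsilon> S)"
    unfolding gap_eq_image[OF assms(1,3)] by (simp add: card_image)
  also have "\<dots> = card (exits \<epsilon> S) - card (last_points \<epsilon> S)"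
    using sub finite_subset[OF sub fin] by (simp add: card_Diff_subset)
  finally show ?thesis
    using card_mono[OF fin sub] card_last_points[OF assms] by simp
qed

theorem theorem1:
  fixes S :: "(real ^ 'n) set"
  assumes "S \<subseteq> int_lattice" and "finite S"
  shows "card (edge_boundary S) = (\<Sum>\<epsilon>\<in>directions. card (proj \<epsilon> S) + card (gap \<epsilon> S))"
  using card_edge_boundary[OF assms] card_exits[OF assms] by simp

end
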